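(* Let $A\subseteq\mathbb N$ be hypersimple. Then for every $n\in\mathbb N$, $F_A\not\leq\omega^{(n)}$.
   Context: A ceer is an equivalence relation on $\mathbb N$ c.e. as a subset of $\mathbb N^2$; $R_1\leq R_2$ means there is a total computable $f$ with $xR_1y\Leftrightarrow f(x)R_2f(y)$. A c.e. set $A$ is hypersimple if its complement is infinite and no computable function $f$ satisfies $f(n)\geq z_n$ for all $n$, where $z_0<z_1<\cdots$ enumerates $\mathbb N\setminus A$. For c.e. $A$, $F_A$ is defined by $xF_Ay\Leftrightarrow x=y\lor\forall z(\min(x,y)\leq z\leq\max(x,y)\to z\in A)$. $\omega$ is the identity relation; with $\varphi_e$ the standard enumeration of partial computable functions, the halting jump of a ceer $E$ is $xE'y\Leftrightarrow x=y\lor(\varphi_x(x)\!\downarrow,\varphi_y(y)\!\downarrow,\ \varphi_x(x)E\varphi_y(y))$; $\omega^{(0)}=\omega$, $\omega^{(n+1)}=(\omega^{(n)})'$. *)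

theory Defs
  imports "HOL-Library.Infinite_Set" "HOL-Library.Nat_Bijection"
begin

text \<open>
  Kleene's schemes.  Arities are not recorded in the syntax: a term denotes, for every
  length of the argument list, a partial function of that many arguments.  In \<open>Pr f g\<close> the
  recursion argument comes first, and \<open>g\<close> receives the counter, the previous value and the
  parameters.
\<close>

datatype recf = Zero | Succ | Proj nat | Cn recf "recf list" | Pr recf recf | Mn recf

fun eval :: "recf \<Rightarrow> nat list \<Rightarrow> nat option" where
  "eval Zero xs = Some 0"
| "eval Succ xs = (case xs of [x] \<Rightarrow> Some (Suc x) | _ \<Rightarrow> None)"
| "eval (Proj i) xs = (if i < length xs then Some (xs ! i) else None)"
| "eval (Cn f gs) xs =
    (if \<forall>g\<in>set gs. eval g xs \<noteq> None
     then eval f (map (\<lambda>g. the (eval g xs)) gs) else None)"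
| "eval (Pr f g) xs =
    (case xs of [] \<Rightarrow> None
     | n # ys \<Rightarrow> rec_nat (eval f ys) (\<lambda>k r. Option.bind r (\<lambda>v. eval g (k # v # ys))) n)"
| "eval (Mn f) xs =
    (if \<exists>z. eval f (z # xs) = Some 0 \<and> (\<forall>y<z. \<exists>v. eval f (y # xs) = Some (Suc v))
     then Some (LEAST z. eval f (z # xs) = Some 0) else None)"

definition partial_computable :: "(nat \<Rightarrow> nat option) \<Rightarrow> bool" where
  "partial_computable g \<longleftrightarrow> (\<exists>r. \<forall>x. g x = eval r [x])"

definition total_computable :: "(nat \<Rightarrow> nat) \<Rightarrow> bool" where
  "total_computable f \<longleftrightarrow> partial_computable (\<lambda>x. Some (f x))"

definition ce :: "nat set \<Rightarrow> bool" where
  "ce A \<longleftrightarrow> (\<exists>g. partial_computable g \<and> A = dom g)"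

lemma prod_decode_le:
  "prod_decode n = (a, b) \<Longrightarrow> a \<le> n" "prod_decode n = (a, b) \<Longrightarrow> b \<le> n"
  by (metis prod_decode_inverse le_prod_encode_1, metis prod_decode_inverse le_prod_encode_2)

lemma list_decode_le: "x \<in> set (list_decode n) \<Longrightarrow> x \<le> n"
proof (induction n rule: list_decode.induct)
  case (2 n)
  obtain a b where ab: "prod_decode n = (a, b)" by fastforce
  show ?case using 2 ab prod_decode_le[OF ab] by fastforce
qed simp

text \<open>
  The Goedel numbering: \<open>e mod 6\<close> selects the scheme and \<open>e div 6\<close> codes its arguments.
  Every number is the code of a term.
\<close>

function decode :: "nat \<Rightarrow> recf" where
  "decode e =
    (let k = e div 6; a = fst (prod_decode k); b = snd (prod_decode k) in
     if e mod 6 = 0 then Zero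
     else if e mod 6 = 1 then Succ
     else if e mod 6 = 2 then Proj k
     else if e mod 6 = 3 then Cn (decode a) (map decode (list_decode b))
     else if e mod 6 = 4 then Pr (decode a) (decode b)
     else Mn (decode k))"
  by pat_completeness auto
termination
proof (relation "measure id", goal_cases)
  case (2 e k a b)
  then show ?case
    using prod_decode_le(1)[of k a b] by (cases e) (auto simp: le_less_trans)
next
  case (3 e k a b z)
  then show ?case
    using prod_decode_le(2)[of k a b] list_decode_le[of z b]
    by (cases e) (auto simp: le_less_trans)
next
  case (4 e k a b)
  then show ?case
    using prod_decode_le(1)[of k a b] by (cases e) (auto simp: le_less_trans)
next
  case (5 e k a b)
  then show ?case
    using prod_decode_le(2)[of k a b] by (cases e) (auto simp: le_less_trans)
next
  case (6 e k a b)
  then show ?case by (cases e) auto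
qed simp

declare decode.simps [simp del]

lemma surj_decode: "surj decode"
proof -
  have "\<exists>e. decode e = r" for r
  proof (induction r)
    case Zero
    have "decode 0 = Zero" by (simp add: decode.simps[of 0])
    then show ?case ..
  next
    case Succ
    have "decode 1 = Succ" by (subst decode.simps) simp
    then show ?case by blast
  next
    case (Proj i)
    have "(6 * i + 2) mod 6 = 2" "(6 * i + 2) div 6 = i" by presburger+
    then have "decode (6 * i + 2) = Proj i" by (subst decode.simps) (simp add: Let_def)
    then show ?case ..
  next
    case (Cn f gs)
    then obtain a where a: "decode a = f" by blast
    have "map decode (map (inv decode) gs) = gs"
      using Cn(2) by (auto intro!: map_idI) (metis f_inv_into_f rangeI)
    with a have "decode (6 * prod_encode (a, list_encode (map (inv decode) gs)) + 3) = Cn f gs"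
      by (subst decode.simps) (simp add: Let_def)
    then show ?case ..
  next
    case (Pr f g)
    then obtain a b where "decode a = f" "decode b = g" by blast
    then have "decode (6 * prod_encode (a, b) + 4) = Pr f g"
      by (subst decode.simps) (simp add: Let_def)
    then show ?case ..
  next
    case (Mn f)
    then obtain a where "decode a = f" by blast
    then have "decode (6 * a + 5) = Mn f" by (subst decode.simps) (simp add: Let_def)
    then show ?case ..
  qed
  then show ?thesis by (metis surjI)
qed

definition phi :: "nat \<Rightarrow> nat \<Rightarrow> nat option" where
  "phi e x = eval (decode e) [x]"

lemma range_phi: "range phi = {g. partial_computable g}"
proof -
  have "partial_computable g \<longleftrightarrow> (\<exists>e. phi e = g)" for g
    unfolding partial_computable_def phi_def fun_eq_iff by (metis surj_decode surjD)
  then show ?thesis by auto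
qed

definition hypersimple :: "nat set \<Rightarrow> bool" where
  "hypersimple A \<longleftrightarrow> ce A \<and> infinite (- A) \<and>
     \<not> (\<exists>f. total_computable f \<and> (\<forall>n. f n \<ge> enumerate (- A) n))"

definition reducible :: "(nat \<Rightarrow> nat \<Rightarrow> bool) \<Rightarrow> (nat \<Rightarrow> nat \<Rightarrow> bool) \<Rightarrow> bool" where
  "reducible R1 R2 \<longleftrightarrow> (\<exists>f. total_computable f \<and> (\<forall>x y. R1 x y \<longleftrightarrow> R2 (f x) (f y)))"

definition F_rel :: "nat set \<Rightarrow> nat \<Rightarrow> nat \<Rightarrow> bool" where
  "F_rel A x y \<longleftrightarrow> x = y \<or> (\<forall>z. min x y \<le> z \<and> z \<le> max x y \<longrightarrow> z \<in> A)"

definition halting_jump :: "(nat \<Rightarrow> nat \<Rightarrow> bool) \<Rightarrow> nat \<Rightarrow> nat \<Rightarrow> bool" where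
  "halting_jump E x y \<longleftrightarrow>
     x = y \<or> (\<exists>u v. phi x x = Some u \<and> phi y y = Some v \<and> E u v)"

primrec omega_jump :: "nat \<Rightarrow> nat \<Rightarrow> nat \<Rightarrow> bool" where
  "omega_jump 0 = (=)"
| "omega_jump (Suc n) = halting_jump (omega_jump n)"

end

theory Submission
  imports Defs
begin

text \<open>
  Write \<open>x\<^sub>0 = x\<close> and \<open>x\<^sub>k\<^sub>+\<^sub>1 = \<phi>\<^bsub>x\<^sub>k\<^esub>(x\<^sub>k)\<close>.  Two numbers are related by the \<open>n\<close>-th jump iff
  \<open>x\<^sub>k\<close> and \<open>y\<^sub>k\<close> are defined and equal for some \<open>k \<le> n\<close>.  Given a reduction \<open>f\<close>, let \<open>k \<le> n\<close> be maximal
  such that \<open>(f x)\<^sub>k\<close> is defined for infinitely many \<open>x\<close>, and let \<open>m\<close> bound the finitely many \<open>x\<close> for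
  which a higher level up to \<open>n\<close> is defined.  For \<open>x, y \<ge> m\<close>, distinct values of \<open>(f x)\<^sub>k\<close> and \<open>(f y)\<^sub>k\<close>
  then certify that the interval between \<open>x\<close> and \<open>y\<close> meets the complement of \<open>A\<close>.  Such a pair exists
  beyond every \<open>a\<close>, because the classes of \<open>F\<^sub>A\<close> are finite, and it can be found by search because the
  graph of the diagonal function is semidecidable.  Iterating the search bounds the enumeration of
  the complement by a computable function, contrary to hypersimplicity.
\<close>

subsection \<open>Closure properties of total computable functions\<close>

lemma total_computable_iff: "total_computable f \<longleftrightarrow> (\<exists>r. \<forall>x. eval r [x] = Some (f x))"
  unfolding total_computable_def partial_computable_def by metis

text \<open>\<open>total_computable\<close> is a notion for unary functions; binary functions enter
  only through a term denoting them, composed here with two unary functions.\<close>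

lemma total_computable_compose2:
  assumes "\<And>a b. eval r [a, b] = Some (F a b)" "total_computable f" "total_computable g"
  shows "total_computable (\<lambda>x. F (f x) (g x))"
proof -
  obtain rf rg where "\<And>x. eval rf [x] = Some (f x)" "\<And>x. eval rg [x] = Some (g x)"
    using assms(2,3) unfolding total_computable_iff by blast
  then have "eval (Cn r [rf, rg]) [x] = Some (F (f x) (g x))" for x
    by (simp add: assms(1))
  then show ?thesis unfolding total_computable_iff by blast
qed

lemma total_computable_id: "total_computable (\<lambda>x. x)"
  unfolding total_computable_iff by (rule exI[of _ "Proj 0"]) simp

lemma total_computable_compose:
  assumes "total_computable f" "total_computable g"
  shows "total_computable (\<lambda>x. f (g x))"
proof -
  obtain rf rg where "\<And>x. eval rf [x] = Some (f x)" "\<And>x. eval rg [x] = Some (g x)"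
    using assms unfolding total_computable_iff by blast
  then have "eval (Cn rf [rg]) [x] = Some (f (g x))" for x by simp
  then show ?thesis unfolding total_computable_iff by blast
qed

lemma total_computable_Suc: "total_computable f \<Longrightarrow> total_computable (\<lambda>x. Suc (f x))"
proof -
  have "total_computable Suc"
    unfolding total_computable_iff by (rule exI[of _ Succ]) simp
  then show "total_computable f \<Longrightarrow> total_computable (\<lambda>x. Suc (f x))"
    by (rule total_computable_compose)
qed

lemma total_computable_const: "total_computable (\<lambda>x. c)"
proof (induction c)
  case 0
  show ?case unfolding total_computable_iff by (rule exI[of _ Zero]) simp
qed (rule total_computable_Suc)

section \<open>Kleene terms for arithmetic and pairing\<close>

definition r_add where "r_add = Pr (Proj 0) (Cn Succ [Proj 1])"

definition r_pred where "r_pred = Pr Zero (Proj 0)"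

text \<open>\<open>Pr\<close> recurses on its first argument, but subtraction recurses on the
  subtrahend; hence the two projections swap the arguments.\<close>

definition r_diff where "r_diff = Cn (Pr (Proj 0) (Cn r_pred [Proj 1])) [Proj 1, Proj 0]"

definition r_mult where "r_mult = Pr Zero (Cn r_add [Proj 1, Proj 2])"

definition r_triangle where "r_triangle = Pr Zero (Cn r_add [Proj 1, Cn Succ [Proj 0]])"

definition r_pair where "r_pair = Cn r_add [Cn r_triangle [r_add], Proj 0]"

lemma eval_r_add: "eval r_add [a, b] = Some (a + b)"
  unfolding r_add_def by (induction a) auto

lemma eval_r_pred: "eval r_pred [a] = Some (a - 1)"
  unfolding r_pred_def by (induction a) auto

lemma eval_r_diff: "eval r_diff [a, b] = Some (a - b)"
  unfolding r_diff_def by (induction b) (auto simp: eval_r_pred)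

lemma eval_r_mult: "eval r_mult [a, b] = Some (a * b)"
  unfolding r_mult_def by (induction a) (auto simp: eval_r_add)

lemma eval_r_triangle: "eval r_triangle [a] = Some (triangle a)"
  unfolding r_triangle_def by (induction a) (auto simp: eval_r_add)

lemma eval_r_pair: "eval r_pair [a, b] = Some (prod_encode (a, b))"
  unfolding r_pair_def by (simp add: eval_r_add eval_r_triangle prod_encode_def)

lemmas total_computable_add = total_computable_compose2[OF eval_r_add]
lemmas total_computable_diff = total_computable_compose2[OF eval_r_diff]
lemmas total_computable_mult = total_computable_compose2[OF eval_r_mult]
lemmas total_computable_pair = total_computable_compose2[OF eval_r_pair]

text \<open>Totality of \<open>F\<close> makes every value below the least zero a defined successor,
  which is the condition under which \<open>Mn\<close> returns a value.\<close>

lemma total_computable_Least_zero: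
  assumes r: "\<And>z x. eval r [z, x] = Some (F z x)" and ex: "\<And>x. \<exists>z. F z x = 0"
  shows "total_computable (\<lambda>x. LEAST z. F z x = 0)"
proof -
  have "eval (Mn r) [x] = Some (LEAST z. F z x = 0)" for x
  proof -
    have "F (LEAST z. F z x = 0) x = 0" using ex[of x] by (rule LeastI_ex)
    moreover have "\<forall>y<(LEAST z. F z x = 0). \<exists>v. F y x = Suc v"
      using not_less_Least not0_implies_Suc by blast
    ultimately have "\<exists>z. F z x = 0 \<and> (\<forall>y<z. \<exists>v. F y x = Suc v)" by blast
    then show ?thesis by (simp add: r)
  qed
  then show ?thesis unfolding total_computable_iff by blast
qed

section \<open>Computability of the inverse of Cantor pairing\<close>

definition pfst :: "nat \<Rightarrow> nat" where "pfst n = fst (prod_decode n)"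

definition psnd :: "nat \<Rightarrow> nat" where "psnd n = snd (prod_decode n)"

lemma pfst_pair [simp]: "pfst (prod_encode (a, b)) = a"
  and psnd_pair [simp]: "psnd (prod_encode (a, b)) = b"
  by (simp_all add: pfst_def psnd_def)

lemma pair_pfst_psnd [simp]: "prod_encode (pfst n, psnd n) = n"
  by (simp add: pfst_def psnd_def)

lemma pfst_psnd_conv: "n = triangle (pfst n + psnd n) + pfst n"
  using pair_pfst_psnd[of n] unfolding prod_encode_def by simp

lemma triangle_mono: "i \<le> j \<Longrightarrow> triangle i \<le> triangle j"
  by (induction j) (auto simp: le_Suc_eq)

text \<open>The diagonal containing \<open>n\<close> is the least \<open>k\<close> with
  \<open>n < triangle (Suc k)\<close>. Written as a vanishing truncated difference, this inequality
  makes the diagonal number a least zero.\<close>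

lemma pfst_add_psnd: "pfst n + psnd n = (LEAST k. Suc n - triangle (Suc k) = 0)"
proof -
  define a b where "a = pfst n" and "b = psnd n"
  have n: "n = triangle (a + b) + a"
    unfolding a_def b_def by (rule pfst_psnd_conv)
  have "(LEAST k. Suc n - triangle (Suc k) = 0) = a + b"
  proof (rule Least_equality)
    show "Suc n - triangle (Suc (a + b)) = 0" by (simp add: n)
  next
    fix k assume k: "Suc n - triangle (Suc k) = 0"
    show "a + b \<le> k"
    proof (rule ccontr)
      assume "\<not> a + b \<le> k"
      then have "triangle (Suc k) \<le> triangle (a + b)" by (intro triangle_mono) simp
      with k n show False by simp
    qed
  qed
  then show ?thesis by (simp add: a_def b_def)
qed

lemma total_computable_triangle: "total_computable f \<Longrightarrow> total_computable (\<lambda>x. triangle (f x))"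
proof -
  have "total_computable triangle"
    unfolding total_computable_iff using eval_r_triangle by blast
  then show "total_computable f \<Longrightarrow> total_computable (\<lambda>x. triangle (f x))"
    by (rule total_computable_compose)
qed

lemma total_computable_pfst_add_psnd: "total_computable (\<lambda>n. pfst n + psnd n)"
  unfolding pfst_add_psnd
proof (rule total_computable_Least_zero)
  show "eval (Cn r_diff [Cn Succ [Proj 1], Cn r_triangle [Cn Succ [Proj 0]]]) [z, x]
      = Some (Suc x - triangle (Suc z))" for z x
    by (simp add: eval_r_diff eval_r_triangle)
  have "n \<le> triangle n" for n by (induction n) auto
  then show "\<exists>z. Suc x - triangle (Suc z) = 0" for x by (metis diff_is_0_eq)
qed

lemma pfst_conv: "pfst n = n - triangle (pfst n + psnd n)"
  using pfst_psnd_conv[of n] by linarith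

lemma total_computable_pfst_id: "total_computable pfst"
proof -
  have "total_computable (\<lambda>n. n - triangle (pfst n + psnd n))"
    by (intro total_computable_diff total_computable_triangle total_computable_id
        total_computable_pfst_add_psnd)
  then show ?thesis by (simp flip: pfst_conv)
qed

lemma total_computable_psnd_id: "total_computable psnd"
proof -
  have "total_computable (\<lambda>n. (pfst n + psnd n) - pfst n)"
    by (intro total_computable_diff total_computable_pfst_id total_computable_pfst_add_psnd)
  then show ?thesis by simp
qed

lemmas total_computable_pfst = total_computable_compose[OF total_computable_pfst_id]
lemmas total_computable_psnd = total_computable_compose[OF total_computable_psnd_id]

text \<open>The step function is assumed computable on the packed triple of counter, previous value
  and parameter; \<open>?g\<close> builds this triple from the three arguments that
  \<open>Pr\<close> supplies.\<close>

lemma total_computable_rec_nat: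
  assumes "total_computable f" "total_computable (\<lambda>p. g (pfst p) (pfst (psnd p)) (psnd (psnd p)))"
    "total_computable n"
  shows "total_computable (\<lambda>x. rec_nat (f x) (\<lambda>k r. g k r x) (n x))"
proof -
  obtain rf rg rn where r: "\<And>x. eval rf [x] = Some (f x)"
      "\<And>p. eval rg [p] = Some (g (pfst p) (pfst (psnd p)) (psnd (psnd p)))"
      "\<And>x. eval rn [x] = Some (n x)"
    using assms unfolding total_computable_iff by blast
  let ?g = "Cn rg [Cn r_pair [Proj 0, Cn r_pair [Proj 1, Proj 2]]]"
  have "eval (Pr rf ?g) [m, x] = Some (rec_nat (f x) (\<lambda>k r. g k r x) m)" for m x
    by (induction m) (simp_all add: r eval_r_pair)
  then have "eval (Cn (Pr rf ?g) [rn, Proj 0]) [x]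
      = Some (rec_nat (f x) (\<lambda>k r. g k r x) (n x))" for x
    using r(3) by (simp del: eval.simps(5))
  then show ?thesis unfolding total_computable_iff by blast
qed

subsection \<open>Decidable predicates\<close>

definition decidable :: "(nat \<Rightarrow> bool) \<Rightarrow> bool" where
  "decidable P \<longleftrightarrow> total_computable (\<lambda>x. of_bool (P x))"

lemma decidable_compose: "decidable P \<Longrightarrow> total_computable f \<Longrightarrow> decidable (\<lambda>x. P (f x))"
  unfolding decidable_def by (rule total_computable_compose)

lemma decidable_not: "decidable P \<Longrightarrow> decidable (\<lambda>x. \<not> P x)"
proof -
  assume "decidable P"
  then have "total_computable (\<lambda>x. 1 - of_bool (P x))"
    unfolding decidable_def by (intro total_computable_diff total_computable_const)
  also have "(\<lambda>x. 1 - of_bool (P x)) = (\<lambda>x. of_bool (\<not> P x) :: nat)" by auto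
  finally show ?thesis unfolding decidable_def .
qed

lemma decidable_conj: "decidable P \<Longrightarrow> decidable Q \<Longrightarrow> decidable (\<lambda>x. P x \<and> Q x)"
  unfolding decidable_def of_bool_conj by (rule total_computable_mult)

lemma decidable_disj: "decidable P \<Longrightarrow> decidable Q \<Longrightarrow> decidable (\<lambda>x. P x \<or> Q x)"
  using decidable_not[OF decidable_conj[OF decidable_not decidable_not]] by fastforce

lemma decidable_imp: "decidable P \<Longrightarrow> decidable Q \<Longrightarrow> decidable (\<lambda>x. P x \<longrightarrow> Q x)"
  unfolding imp_conv_disj by (intro decidable_disj decidable_not)

lemma decidable_le:
  assumes "total_computable f" "total_computable g"
  shows "decidable (\<lambda>x. f x \<le> g x)"
proof -
  have "total_computable (\<lambda>x. 1 - (f x - g x))"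
    by (intro total_computable_diff total_computable_const assms)
  also have "(\<lambda>x. 1 - (f x - g x)) = (\<lambda>x. of_bool (f x \<le> g x))" by auto
  finally show ?thesis unfolding decidable_def .
qed

lemma decidable_less:
  assumes "total_computable f" "total_computable g"
  shows "decidable (\<lambda>x. f x < g x)"
  using decidable_not[OF decidable_le[OF assms(2,1)]] by (simp add: not_le)

lemma decidable_eq:
  assumes "total_computable f" "total_computable g"
  shows "decidable (\<lambda>x. f x = g x)"
  using decidable_conj[OF decidable_le[OF assms] decidable_le[OF assms(2,1)]]
  by (simp add: eq_iff)

text \<open>The characteristic function of a bounded universal quantifier is a product of
  characteristic values, computed by recursion on the bound.\<close>

lemma decidable_all_less:
  assumes P: "decidable (\<lambda>p. P (pfst p) (psnd p))" and b: "total_computable b"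
  shows "decidable (\<lambda>x. \<forall>y<b x. P y x)"
proof -
  have P': "total_computable (\<lambda>p. of_bool (P (pfst p) (psnd (psnd p))))"
    using total_computable_compose[OF P[unfolded decidable_def],
        of "\<lambda>p. prod_encode (pfst p, psnd (psnd p))"]
    by (simp add: total_computable_pair total_computable_pfst total_computable_psnd
        total_computable_id)
  have "total_computable (\<lambda>x. rec_nat 1 (\<lambda>y r. r * of_bool (P y x)) (b x))"
    by (intro total_computable_rec_nat total_computable_mult total_computable_pfst
        total_computable_psnd total_computable_id total_computable_const b P')
  moreover have "rec_nat 1 (\<lambda>y r. r * of_bool (P y x)) m = (of_bool (\<forall>y<m. P y x) :: nat)" for m x
    by (induction m) (auto simp: less_Suc_eq)
  ultimately show ?thesis unfolding decidable_def by simp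
qed

text \<open>All witnesses obey a computable bound, so the quantifier is a bounded one in disguise.
  The existential clauses of \<open>supported\<close> are decided in this way.\<close>

lemma decidable_ex_bounded:
  assumes P: "decidable (\<lambda>p. P (pfst p) (psnd p))" and b: "total_computable b"
    and "\<And>x y. P y x \<Longrightarrow> y \<le> b x"
  shows "decidable (\<lambda>x. \<exists>y. P y x)"
proof -
  have "decidable (\<lambda>x. \<not> (\<forall>y<Suc (b x). \<not> P y x))"
    by (intro decidable_not decidable_all_less total_computable_Suc P b)
  moreover have "(\<not> (\<forall>y<Suc (b x). \<not> P y x)) \<longleftrightarrow> (\<exists>y. P y x)" for x
    using assms(3) by (auto simp: less_Suc_eq_le)
  ultimately show ?thesis by simp
qed

lemma total_computable_Least:
  assumes P: "decidable (\<lambda>p. P (pfst p) (psnd p))" and ex: "\<And>x. \<exists>z. P z x"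
  shows "total_computable (\<lambda>x. LEAST z. P z x)"
proof -
  obtain r where r: "\<And>p. eval r [p] = Some (of_bool (\<not> P (pfst p) (psnd p)))"
    using decidable_not[OF P] unfolding decidable_def total_computable_iff by blast
  have "total_computable (\<lambda>x. LEAST z. of_bool (\<not> P z x) = (0::nat))"
    by (rule total_computable_Least_zero[where r = "Cn r [r_pair]"])
      (auto simp: eval_r_pair r ex)
  then show ?thesis by simp
qed

lemmas total_computable_basic = total_computable_id total_computable_const total_computable_Suc
  total_computable_add total_computable_diff total_computable_mult total_computable_pair
  total_computable_pfst total_computable_psnd

section \<open>Division, powers and membership in finite sets coded in binary\<close>

lemma total_computable_div:
  assumes "total_computable f" "total_computable g"
  shows "total_computable (\<lambda>x. f x div g x)"
proof -
  \<comment> \<open>For divisor \<open>0\<close> the first disjunct stops the search at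
    \<open>0\<close>, the HOL value of division by zero.\<close>
  have "total_computable (\<lambda>p. LEAST q. psnd p = 0 \<or> pfst p < psnd p * Suc q)"
    (is "total_computable ?d")
  proof (rule total_computable_Least)
    show "decidable (\<lambda>p. psnd (psnd p) = 0 \<or> pfst (psnd p) < psnd (psnd p) * Suc (pfst p))"
      by (intro decidable_disj decidable_eq decidable_less total_computable_basic)
    show "\<exists>q. psnd p = 0 \<or> pfst p < psnd p * Suc q" for p
      by (metis div_less_iff_less_mult less_Suc_eq mult.commute neq0_conv)
  qed
  from total_computable_compose[OF this total_computable_pair[OF assms]]
  have "total_computable (\<lambda>x. LEAST q. g x = 0 \<or> f x < g x * Suc q)" by simp
  moreover have "(LEAST q. b = 0 \<or> a < b * Suc q) = a div b" for a b :: nat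
  proof (cases "b = 0")
    case False
    then have "a < b * Suc q \<longleftrightarrow> a div b \<le> q" for q
      by (metis div_less_iff_less_mult less_Suc_eq_le mult.commute neq0_conv)
    then show ?thesis using False by (auto intro: Least_equality)
  qed (simp add: Least_equality)
  ultimately show ?thesis by simp
qed

lemma total_computable_mod:
  assumes "total_computable f" "total_computable g"
  shows "total_computable (\<lambda>x. f x mod g x)"
proof -
  have "total_computable (\<lambda>x. f x - g x * (f x div g x))"
    by (intro total_computable_basic total_computable_div assms)
  then show ?thesis by (simp add: minus_mult_div_eq_mod)
qed

lemma total_computable_power:
  assumes "total_computable f"
  shows "total_computable (\<lambda>x. c ^ f x)"
proof -
  have "total_computable (\<lambda>x. rec_nat 1 (\<lambda>_ r. c * r) (f x))"
    by (intro total_computable_rec_nat total_computable_basic assms)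
  moreover have "rec_nat 1 (\<lambda>_ r. c * r) n = c ^ n" for n by (induction n) auto
  ultimately show ?thesis by simp
qed

lemma decidable_set_decode:
  assumes "total_computable f" "total_computable g"
  shows "decidable (\<lambda>x. f x \<in> set_decode (g x))"
proof -
  have "decidable (\<lambda>x. g x div 2 ^ f x mod 2 = 1)"
    by (intro decidable_eq total_computable_basic total_computable_div total_computable_mod
        total_computable_power assms)
  then show ?thesis by (simp add: set_decode_def odd_iff_mod_2_eq_one)
qed

subsection \<open>Codes of lists\<close>

definition lcons :: "nat \<Rightarrow> nat \<Rightarrow> nat" where "lcons x c = Suc (prod_encode (x, c))"

text \<open>The empty list has code \<open>0\<close>, and \<open>psnd (0 - 1) = 0\<close>, so
  \<open>ldrop\<close> stays at \<open>0\<close> past the end of the list.\<close>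

definition ldrop :: "nat \<Rightarrow> nat \<Rightarrow> nat" where "ldrop i c = rec_nat c (\<lambda>_ r. psnd (r - 1)) i"

definition lnth :: "nat \<Rightarrow> nat \<Rightarrow> nat" where "lnth c i = pfst (ldrop i c - 1)"

definition llen :: "nat \<Rightarrow> nat" where "llen c = (LEAST i. ldrop i c = 0)"

lemma list_decode_lcons [simp]: "list_decode (lcons x c) = x # list_decode c"
  by (simp add: lcons_def)

lemma lcons_eq: "lcons x (list_encode xs) = list_encode (x # xs)"
  by (simp add: lcons_def)

lemma ldrop_conv: "ldrop i (list_encode xs) = list_encode (drop i xs)"
proof (induction i)
  case (Suc i)
  have "psnd (list_encode ys - 1) = list_encode (tl ys)" for ys
  proof (cases ys)
    case Nil
    then show ?thesis using psnd_pair[of 0 0, unfolded prod_encode_def] by simp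
  qed simp
  with Suc show ?case by (simp add: ldrop_def drop_Suc tl_drop)
qed (simp add: ldrop_def)

lemma list_encode_eq_0: "list_encode xs = 0 \<longleftrightarrow> xs = []"
  by (cases xs) auto

lemma lnth_conv: "i < length xs \<Longrightarrow> lnth (list_encode xs) i = xs ! i"
  by (simp add: lnth_def ldrop_conv flip: Cons_nth_drop_Suc)

lemma llen_conv: "llen (list_encode xs) = length xs"
  unfolding llen_def ldrop_conv list_encode_eq_0 by (rule Least_equality) auto

lemma total_computable_lcons:
  "total_computable f \<Longrightarrow> total_computable g \<Longrightarrow> total_computable (\<lambda>x. lcons (f x) (g x))"
  unfolding lcons_def by (intro total_computable_basic)

lemma total_computable_ldrop:
  "total_computable f \<Longrightarrow> total_computable g \<Longrightarrow> total_computable (\<lambda>x. ldrop (f x) (g x))"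
  unfolding ldrop_def by (intro total_computable_rec_nat total_computable_basic)

lemma total_computable_lnth:
  "total_computable f \<Longrightarrow> total_computable g \<Longrightarrow> total_computable (\<lambda>x. lnth (f x) (g x))"
  unfolding lnth_def by (intro total_computable_ldrop total_computable_basic)

lemma total_computable_llen:
  assumes "total_computable f"
  shows "total_computable (\<lambda>x. llen (f x))"
proof -
  have "total_computable llen"
    unfolding llen_def
  proof (rule total_computable_Least)
    show "decidable (\<lambda>p. ldrop (pfst p) (psnd p) = 0)"
      by (intro decidable_eq total_computable_ldrop total_computable_basic)
    show "\<exists>i. ldrop i c = 0" for c
      using ldrop_conv[of "length (list_decode c)" "list_decode c"] by auto
  qed
  then show ?thesis using assms by (rule total_computable_compose)
qed

lemmas total_computable_more = total_computable_basic total_computable_lcons total_computable_lnth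
  total_computable_llen total_computable_div total_computable_mod

subsection \<open>Certificates for computations\<close>

text \<open>A certificate is a finite set of facts \<open>(e, c, v)\<close>, each asserting that the term with code \<open>e\<close>
  returns \<open>v\<close> on the argument list with code \<open>c\<close>; it is closed if each of its facts follows from others
  by one unfolding of \<open>eval\<close>.  No order on the facts is needed to exclude circular support: every
  unfolding decreases \<open>e\<close>, or keeps \<open>e\<close> and decreases the recursion argument.\<close>

definition eval_fact :: "nat \<Rightarrow> nat \<Rightarrow> nat \<Rightarrow> nat" where
  "eval_fact e c v = prod_encode (e, prod_encode (c, v))"

lemma total_computable_eval_fact:
  assumes "total_computable e" "total_computable c" "total_computable v"
  shows "total_computable (\<lambda>x. eval_fact (e x) (c x) (v x))"
  unfolding eval_fact_def by (intro total_computable_pair assms)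

text \<open>Each existential variable is a component of a fact required to lie in \<open>S\<close>;
  this bounds the quantifiers once \<open>S\<close> is given by a code. Primitive recursion takes
  two disjuncts, one for a zero and one for a successor recursion argument.\<close>

definition supported :: "nat set \<Rightarrow> nat \<Rightarrow> nat \<Rightarrow> nat \<Rightarrow> bool" where
  "supported S e c v \<longleftrightarrow>
     e mod 6 = 0 \<and> v = 0 \<or>
     e mod 6 = 1 \<and> llen c = 1 \<and> v = Suc (lnth c 0) \<or>
     e mod 6 = 2 \<and> e div 6 < llen c \<and> v = lnth c (e div 6) \<or>
     e mod 6 = 3 \<and> (\<exists>d. eval_fact (pfst (e div 6)) d v \<in> S \<and> llen d = llen (psnd (e div 6)) \<and>
       (\<forall>i<llen d. eval_fact (lnth (psnd (e div 6)) i) c (lnth d i) \<in> S)) \<or>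
     e mod 6 = 4 \<and> (\<exists>d. eval_fact (pfst (e div 6)) d v \<in> S \<and> c = lcons 0 d) \<or>
     e mod 6 = 4 \<and> (\<exists>k. \<exists>r. \<exists>d. eval_fact e (lcons k d) r \<in> S \<and> c = lcons (Suc k) d \<and>
        eval_fact (psnd (e div 6)) (lcons k (lcons r d)) v \<in> S) \<or>
     e mod 6 = 5 \<and> eval_fact (e div 6) (lcons v c) 0 \<in> S \<and>
       (\<forall>y<v. \<exists>w. eval_fact (e div 6) (lcons y c) (Suc w) \<in> S)"

definition closed :: "nat set \<Rightarrow> bool" where
  "closed S \<longleftrightarrow> (\<forall>e c v. eval_fact e c v \<in> S \<longrightarrow> supported S e c v)"

section \<open>Soundness of certificates\<close>

lemma decode_cases:
  "e mod 6 = 0 \<Longrightarrow> decode e = Zero"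
  "e mod 6 = 1 \<Longrightarrow> decode e = Succ"
  "e mod 6 = 2 \<Longrightarrow> decode e = Proj (e div 6)"
  "e mod 6 = 3 \<Longrightarrow>
    decode e = Cn (decode (pfst (e div 6))) (map decode (list_decode (psnd (e div 6))))"
  "e mod 6 = 4 \<Longrightarrow> decode e = Pr (decode (pfst (e div 6))) (decode (psnd (e div 6)))"
  "e mod 6 = 5 \<Longrightarrow> decode e = Mn (decode (e div 6))"
  by (subst decode.simps, simp add: Let_def pfst_def psnd_def)+

lemma pfst_le: "pfst n \<le> n" and psnd_le: "psnd n \<le> n"
  using prod_decode_le[of n "pfst n" "psnd n"] by (simp_all add: pfst_def psnd_def)

text \<open>A nonzero residue forces \<open>e > 0\<close>, hence \<open>e div 6 < e\<close>, and
  components of a code never exceed it. These inequalities drive the inductions on codes.\<close>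

lemma code_less:
  assumes "e mod 6 = m" "m \<noteq> 0"
  shows "e div 6 < e" "pfst (e div 6) < e" "psnd (e div 6) < e"
    "g \<in> set (list_decode (psnd (e div 6))) \<Longrightarrow> g < e"
proof -
  show *: "e div 6 < e" using assms by (cases e) auto
  then show "pfst (e div 6) < e" "psnd (e div 6) < e"
    using pfst_le[of "e div 6"] psnd_le[of "e div 6"] by linarith+
  then show "g \<in> set (list_decode (psnd (e div 6))) \<Longrightarrow> g < e"
    using list_decode_le by fastforce
qed

lemma llen_list_decode: "llen c = length (list_decode c)"
  using llen_conv[of "list_decode c"] by simp

lemma lnth_list_decode: "i < length (list_decode c) \<Longrightarrow> lnth c i = list_decode c ! i"
  using lnth_conv[of i "list_decode c"] by simp

text \<open>Strong induction on the code: the facts supporting a given fact have smaller codes,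
  except the previous value of a primitive recursion.\<close>

lemma closed_sound:
  assumes S: "closed S"
  shows "eval_fact e c v \<in> S \<Longrightarrow> eval (decode e) (list_decode c) = Some v"
proof (induction e arbitrary: c v rule: less_induct)
  case (less e)
  have sup: "supported S e c v" using less(2) S unfolding closed_def by blast
  consider "e mod 6 = 0" | "e mod 6 = 1" | "e mod 6 = 2" | "e mod 6 = 3"
    | "e mod 6 = 4" | "e mod 6 = 5"
    by linarith
  then show ?case
  proof cases
    case 1
    from sup have "v = 0" unfolding supported_def 1 by simp
    then show ?thesis by (simp add: decode_cases(1)[OF 1])
  next
    case 2
    from sup have "length (list_decode c) = 1" "v = Suc (lnth c 0)"
      unfolding supported_def 2 by (simp_all add: llen_list_decode)
    then show ?thesis
      by (auto simp: decode_cases(2)[OF 2] lnth_list_decode length_Suc_conv)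
  next
    case 3
    from sup have "e div 6 < llen c" "v = lnth c (e div 6)"
      unfolding supported_def 3 by simp_all
    then show ?thesis
      by (simp add: decode_cases(3)[OF 3] llen_list_decode lnth_list_decode)
  next
    case 4
    from sup obtain d where d: "eval_fact (pfst (e div 6)) d v \<in> S"
      "llen d = llen (psnd (e div 6))"
      "\<And>i. i < llen d \<Longrightarrow> eval_fact (lnth (psnd (e div 6)) i) c (lnth d i) \<in> S"
      unfolding supported_def 4 by auto
    let ?gs = "list_decode (psnd (e div 6))"
    have g: "eval (decode (?gs ! i)) (list_decode c) = Some (list_decode d ! i)"
      if "i < length ?gs" for i
    proof (rule less.IH)
      show "?gs ! i < e" using code_less(4)[OF 4] that by simp
      show "eval_fact (?gs ! i) c (list_decode d ! i) \<in> S"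
        using d(2) d(3)[of i] that by (simp add: llen_list_decode lnth_list_decode)
    qed
    then have "map (\<lambda>g. the (eval (decode g) (list_decode c))) ?gs = list_decode d"
      using d(2) by (auto intro!: nth_equalityI simp: llen_list_decode)
    moreover have "\<forall>g\<in>set ?gs. eval (decode g) (list_decode c) \<noteq> None"
      using g by (auto simp: in_set_conv_nth)
    moreover have "eval (decode (pfst (e div 6))) (list_decode d) = Some v"
      using less.IH[OF code_less(2)[OF 4] d(1)] by simp
    ultimately show ?thesis by (simp add: decode_cases(4)[OF 4] comp_def)
  next
    case 5
    \<comment> \<open>The previous value carries the same code \<open>e\<close>, out of reach of the
      outer hypothesis; an inner induction on the recursion argument replaces it.\<close>
    have "eval_fact e c v \<in> S \<Longrightarrow> list_decode c = n # ys
        \<Longrightarrow> eval (decode e) (n # ys) = Some v" for n ys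
    proof (induction n arbitrary: c v)
      case 0
      then have "supported S e c v" using S unfolding closed_def by blast
      with 0(2) obtain d where "eval_fact (pfst (e div 6)) d v \<in> S" "c = lcons 0 d"
        unfolding supported_def 5 by auto
      with 0(2) less.IH[OF code_less(2)[OF 5], of d v] show ?case
        by (simp add: decode_cases(5)[OF 5])
    next
      case (Suc k)
      then have "supported S e c v" using S unfolding closed_def by blast
      with Suc(3) obtain d r where d: "eval_fact e (lcons k d) r \<in> S"
        "c = lcons (Suc k) d" "eval_fact (psnd (e div 6)) (lcons k (lcons r d)) v \<in> S"
        unfolding supported_def 5 by auto
      with Suc less.IH[OF code_less(3)[OF 5] d(3)] have
        "eval (decode e) (k # ys) = Some r"
        "eval (decode (psnd (e div 6))) (k # r # ys) = Some v"
        by auto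
      then show ?case by (simp add: decode_cases(5)[OF 5])
    qed
    moreover have "list_decode c \<noteq> []"
      using sup unfolding supported_def 5 by auto
    ultimately show ?thesis using less(2) by (metis list.exhaust)
  next
    case 6
    from sup have s: "eval_fact (e div 6) (lcons v c) 0 \<in> S"
      "\<And>y. y < v \<Longrightarrow> \<exists>w. eval_fact (e div 6) (lcons y c) (Suc w) \<in> S"
      unfolding supported_def 6 by simp_all
    have z: "eval (decode (e div 6)) (v # list_decode c) = Some 0"
      using less.IH[OF code_less(1)[OF 6] s(1)] by simp
    have y: "\<exists>w. eval (decode (e div 6)) (y # list_decode c) = Some (Suc w)" if "y < v" for y
      using s(2)[OF that] less.IH[OF code_less(1)[OF 6]] by fastforce
    have "(LEAST z. eval (decode (e div 6)) (z # list_decode c) = Some 0) = v"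
    proof (rule Least_equality)
      fix u assume u: "eval (decode (e div 6)) (u # list_decode c) = Some 0"
      show "v \<le> u"
      proof (rule ccontr)
        assume "\<not> v \<le> u"
        then show False using y[of u] u by auto
      qed
    qed (rule z)
    with z y show ?thesis by (auto simp: decode_cases(6)[OF 6])
  qed
qed

section \<open>Completeness of certificates\<close>

lemma supported_mono: "supported S e c v \<Longrightarrow> S \<subseteq> T \<Longrightarrow> supported T e c v"
  unfolding supported_def by (elim disj_forward conj_forward ex_forward all_forward imp_forward; blast)

definition certified :: "nat \<Rightarrow> nat \<Rightarrow> nat \<Rightarrow> bool" where
  "certified e c v \<longleftrightarrow> (\<exists>S. finite S \<and> closed S \<and> eval_fact e c v \<in> S)"

lemma eval_fact_inject [simp]: "eval_fact e c v = eval_fact e' c' v' \<longleftrightarrow> e = e' \<and> c = c' \<and> v = v'"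
  by (simp add: eval_fact_def)

text \<open>The certificates of the finitely many premises are united and the new fact is added.
  Facts occur only positively in \<open>supported\<close>, so every old fact keeps its support in
  the larger set.\<close>

lemma certified_if_supported:
  assumes Q: "finite Q" "\<forall>q\<in>Q. case q of (e, c, v) \<Rightarrow> certified e c v"
    and "supported ((\<lambda>(e, c, v). eval_fact e c v) ` Q) e c v"
  shows "certified e c v"
proof -
  obtain T where T: "\<forall>(a, b, d)\<in>Q. finite (T (a, b, d)) \<and> closed (T (a, b, d))
      \<and> eval_fact a b d \<in> T (a, b, d)"
    using Q(2) unfolding certified_def split_beta by (metis (no_types, lifting) prod.collapse)
  let ?S = "insert (eval_fact e c v) (\<Union>q\<in>Q. T q)"
  have "finite ?S" using T Q(1) by auto
  moreover have "closed ?S"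
  proof -
    have "supported ?S e c v"
      using assms(3) by (rule supported_mono) (use T in auto)
    moreover have "supported ?S a b d" if "q \<in> Q" "eval_fact a b d \<in> T q" for q a b d
    proof -
      have "supported (T q) a b d" using T that unfolding closed_def by (cases q) auto
      then show ?thesis by (rule supported_mono) (use that in auto)
    qed
    ultimately show ?thesis unfolding closed_def by auto
  qed
  ultimately show ?thesis unfolding certified_def by blast
qed

text \<open>The induction mirrors the one for soundness: a terminating evaluation has finitely many
  immediate subevaluations, and their certificates combine into one.\<close>

lemma certified_complete:
  "eval (decode e) (list_decode c) = Some v \<Longrightarrow> certified e c v"
proof (induction e arbitrary: c v rule: less_induct)
  case (less e)
  consider "e mod 6 = 0" | "e mod 6 = 1" | "e mod 6 = 2" | "e mod 6 = 3"
    | "e mod 6 = 4" | "e mod 6 = 5"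
    by linarith
  then show ?case
  proof cases
    case 1
    with less(2) show ?thesis
      by (intro certified_if_supported[of "{}"])
        (auto simp: decode_cases(1) supported_def)
  next
    case 2
    with less(2) have "list_decode c = [v - 1]" "v > 0"
      by (auto simp: decode_cases(2) split: list.splits)
    then have "llen c = 1" "v = Suc (lnth c 0)"
      by (auto simp: llen_list_decode lnth_list_decode)
    with 2 show ?thesis
      by (intro certified_if_supported[of "{}"]) (auto simp: supported_def)
  next
    case 3
    with less(2) have "e div 6 < llen c" "v = lnth c (e div 6)"
      by (auto simp: decode_cases(3) llen_list_decode lnth_list_decode split: if_splits)
    with 3 show ?thesis
      by (intro certified_if_supported[of "{}"]) (auto simp: supported_def)
  next
    case 4
    let ?gs = "list_decode (psnd (e div 6))"
    \<comment> \<open>The code of the list of intermediate values; \<open>the\<close> is harmless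
      because all of them are defined.\<close>
    let ?d = "list_encode (map (\<lambda>g. the (eval (decode g) (list_decode c))) ?gs)"
    have g: "\<forall>g\<in>set ?gs. eval (decode g) (list_decode c) \<noteq> None"
      and f: "eval (decode (pfst (e div 6))) (list_decode ?d) = Some v"
      using less(2) by (auto simp: decode_cases(4)[OF 4] comp_def split: if_splits)
    let ?G = "(\<lambda>g. (g, c, the (eval (decode g) (list_decode c)))) ` set ?gs"
    let ?Q = "insert (pfst (e div 6), ?d, v) ?G"
    show ?thesis
    proof (rule certified_if_supported[of ?Q])
      show "\<forall>q\<in>?Q. case q of (e, c, v) \<Rightarrow> certified e c v"
        using less.IH[OF code_less(2)[OF 4] f] less.IH[OF code_less(4)[OF 4]] g by auto
      have "llen ?d = llen (psnd (e div 6))" by (simp add: llen_list_decode)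
      moreover have "eval_fact (lnth (psnd (e div 6)) i) c (lnth ?d i)
          \<in> (\<lambda>(e, c, v). eval_fact e c v) ` ?G" if "i < llen ?d" for i
        using that by (force simp: llen_list_decode lnth_list_decode)
      ultimately have "\<exists>d. eval_fact (pfst (e div 6)) d v \<in> (\<lambda>(e, c, v). eval_fact e c v) ` ?Q
          \<and> llen d = llen (psnd (e div 6)) \<and> (\<forall>i<llen d.
            eval_fact (lnth (psnd (e div 6)) i) c (lnth d i) \<in> (\<lambda>(e, c, v). eval_fact e c v) ` ?Q)"
        by (intro exI[of _ ?d]) (simp only: image_insert insert_iff split_conv simp_thms, blast)
      then show "supported ((\<lambda>(e, c, v). eval_fact e c v) ` ?Q) e c v"
        unfolding supported_def using 4 by blast
    qed simp
  next
    case 5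
    from less(2) obtain n ys where c: "c = list_encode (n # ys)"
      using 5 by (cases "list_decode c")
        (auto simp: decode_cases(5), metis list_decode_inverse list_encode.simps(2))
    have "eval (decode e) (n # ys) = Some v \<Longrightarrow> certified e (lcons n (list_encode ys)) v"
    proof (induction n arbitrary: v)
      case 0
      then have "certified (pfst (e div 6)) (list_encode ys) v"
        by (intro less.IH code_less(2)[OF 5]) (simp_all add: decode_cases(5)[OF 5])
      then show ?case
        using 5 by (intro certified_if_supported[of "{(pfst (e div 6), list_encode ys, v)}"])
          (auto simp: supported_def)
    next
      case (Suc k)
      let ?d = "list_encode ys"
      from Suc.prems obtain r where r: "eval (decode e) (k # ys) = Some r"
        "eval (decode (psnd (e div 6))) (k # r # ys) = Some v"
        by (auto simp: decode_cases(5)[OF 5] bind_eq_Some_conv)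
      have "certified e (lcons k ?d) r" using Suc.IH[OF r(1)] .
      moreover have "certified (psnd (e div 6)) (lcons k (lcons r ?d)) v"
        using r(2) by (intro less.IH code_less(3)[OF 5]) simp_all
      ultimately show ?case
        using 5 by (intro certified_if_supported[of "{(e, lcons k ?d, r),
          (psnd (e div 6), lcons k (lcons r ?d), v)}"]) (simp_all add: supported_def, blast)
    qed
    with less(2) c show ?thesis by (simp add: lcons_eq del: list_encode.simps)
  next
    case 6
    let ?f = "\<lambda>z. eval (decode (e div 6)) (z # list_decode c)"
    from less(2) have ex: "\<exists>z. ?f z = Some 0 \<and> (\<forall>y<z. \<exists>w. ?f y = Some (Suc w))"
      and v: "v = (LEAST z. ?f z = Some 0)"
      by (auto simp: decode_cases(6)[OF 6] split: if_splits)
    from ex obtain z where z: "?f z = Some 0" "\<forall>y<z. \<exists>w. ?f y = Some (Suc w)" by blast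
    have "v \<le> z" unfolding v using z(1) by (rule Least_le)
    \<comment> \<open>\<open>W y\<close> is the predecessor of the nonzero value at
      \<open>y\<close>. These values and the zero at \<open>v\<close> are the premises of the
      minimization.\<close>
    with z obtain W where W: "\<forall>y<v. ?f y = Some (Suc (W y))" by (metis less_le_trans)
    have f0: "?f v = Some 0" unfolding v using z(1) by (rule LeastI)
    let ?Y = "(\<lambda>y. (e div 6, lcons y c, Suc (W y))) ` {..<v}"
    let ?Q = "insert (e div 6, lcons v c, 0) ?Y"
    show ?thesis
    proof (rule certified_if_supported[of ?Q])
      show "\<forall>q\<in>?Q. case q of (e, c, v) \<Rightarrow> certified e c v"
        using less.IH[OF code_less(1)[OF 6]] f0 W by auto
      have "eval_fact (e div 6) (lcons v c) 0 \<in> (\<lambda>(e, c, v). eval_fact e c v) ` ?Q"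
        "\<forall>y<v. \<exists>w. eval_fact (e div 6) (lcons y c) (Suc w) \<in> (\<lambda>(e, c, v). eval_fact e c v) ` ?Q"
        by (simp, force)
      then show "supported ((\<lambda>(e, c, v). eval_fact e c v) ` ?Q) e c v"
        unfolding supported_def using 6 by blast
    qed simp
  qed
qed

section \<open>Decidability of being a certificate\<close>

lemma set_decode_le: "p \<in> set_decode D \<Longrightarrow> p \<le> D"
proof -
  assume "p \<in> set_decode D"
  then have "D div 2 ^ p \<noteq> 0" unfolding set_decode_def by (metis even_zero mem_Collect_eq)
  then have "2 ^ p \<le> D" by (simp add: div_eq_0_iff not_less)
  then show "p \<le> D" using less_exp[of p] by linarith
qed

lemma eval_fact_le:
  assumes "eval_fact e c v \<in> set_decode D"
  shows "e \<le> D" "c \<le> D" "v \<le> D"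
  using set_decode_le[OF assms] unfolding eval_fact_def
  using le_prod_encode_1 le_prod_encode_2 le_trans by blast+

lemma lcons_le: "lcons k d \<le> n \<Longrightarrow> k \<le> n" "lcons k d \<le> n \<Longrightarrow> d \<le> n"
  using le_prod_encode_1[of k d] le_prod_encode_2[of d k] by (simp_all add: lcons_def)

text \<open>Elements of a binary-coded set, and hence the components of its facts, are at most the
  code \<open>D x\<close>; this bounds every existential witness. The universal quantifiers carry
  bounds already.\<close>

lemma decidable_supported:
  assumes "total_computable D" "total_computable e" "total_computable c" "total_computable v"
  shows "decidable (\<lambda>x. supported (set_decode (D x)) (e x) (c x) (v x))"
proof -
  note D = total_computable_compose[OF assms(1)] and e = total_computable_compose[OF assms(2)]
    and c = total_computable_compose[OF assms(3)] and v = total_computable_compose[OF assms(4)]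
  note dec = decidable_conj decidable_eq decidable_less decidable_all_less decidable_set_decode
    total_computable_more total_computable_eval_fact assms D e c v
  \<comment> \<open>The same bound \<open>D\<close>, read under one and under two further quantified
    variables packed in front of the argument.\<close>
  have D1: "total_computable (\<lambda>p. D (psnd p))" and D2: "total_computable (\<lambda>p. D (psnd (psnd p)))"
    by (intro dec)+
  note ex0 = decidable_ex_bounded[OF _ assms(1)] and ex1 = decidable_ex_bounded[OF _ D1]
    and ex2 = decidable_ex_bounded[OF _ D2]
  have 3: "decidable (\<lambda>x. \<exists>d. eval_fact (pfst (e x div 6)) d (v x) \<in> set_decode (D x)
      \<and> llen d = llen (psnd (e x div 6)) \<and>
       (\<forall>i<llen d. eval_fact (lnth (psnd (e x div 6)) i) (c x) (lnth d i) \<in> set_decode (D x)))"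
    by (rule ex0) (intro dec, auto intro: eval_fact_le)
  have 4: "decidable (\<lambda>x. \<exists>d. eval_fact (pfst (e x div 6)) d (v x) \<in> set_decode (D x)
      \<and> c x = lcons 0 d)"
    by (rule ex0) (intro dec, auto intro: eval_fact_le)
  have 5: "decidable (\<lambda>x. \<exists>k. \<exists>r. \<exists>d. eval_fact (e x) (lcons k d) r \<in> set_decode (D x)
        \<and> c x = lcons (Suc k) d
        \<and> eval_fact (psnd (e x div 6)) (lcons k (lcons r d)) (v x) \<in> set_decode (D x))"
    by (rule ex0, rule ex1, rule ex2)
      (intro dec,
        auto intro: eval_fact_le(3) lcons_le[OF eval_fact_le(2)])
  have "decidable (\<lambda>p. \<exists>w. eval_fact (e (psnd p) div 6) (lcons (pfst p) (c (psnd p))) (Suc w)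
      \<in> set_decode (D (psnd p)))"
    by (rule ex1) (intro dec, auto dest: eval_fact_le(3))
  then have 6: "decidable (\<lambda>x. \<forall>y<v x. \<exists>w. eval_fact (e x div 6) (lcons y (c x)) (Suc w)
      \<in> set_decode (D x))"
    using assms(4) by (rule decidable_all_less)
  show ?thesis
    unfolding supported_def
    by (intro 3 4 5 6 decidable_disj dec)
qed

text \<open>Every number codes a fact, so the three quantifiers of \<open>closed\<close> merge into
  one over the elements of the set, all of which are at most \<open>D\<close>.\<close>

lemma decidable_closed: "decidable (\<lambda>D. closed (set_decode D))"
proof -
  have "decidable (\<lambda>D. \<forall>p<Suc D. p \<in> set_decode D \<longrightarrow>
      supported (set_decode D) (pfst p) (pfst (psnd p)) (psnd (psnd p)))"
    by (intro decidable_all_less decidable_imp decidable_set_decode decidable_supported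
        total_computable_basic)
  also have "(\<lambda>D. \<forall>p<Suc D. p \<in> set_decode D \<longrightarrow>
      supported (set_decode D) (pfst p) (pfst (psnd p)) (psnd (psnd p)))
      = (\<lambda>D. closed (set_decode D))"
  proof
    fix D
    have "p < Suc D" if "p \<in> set_decode D" for p
      using set_decode_le[OF that] by simp
    then show "(\<forall>p<Suc D. p \<in> set_decode D \<longrightarrow>
      supported (set_decode D) (pfst p) (pfst (psnd p)) (psnd (psnd p)))
      = closed (set_decode D)"
      unfolding closed_def eval_fact_def
      by (metis pair_pfst_psnd pfst_pair psnd_pair)
  qed
  finally show ?thesis .
qed

subsection \<open>Semidecidable predicates\<close>

definition semidecidable :: "(nat \<Rightarrow> bool) \<Rightarrow> bool" where
  "semidecidable P \<longleftrightarrow> (\<exists>Q. decidable Q \<and> (\<forall>x. P x \<longleftrightarrow> (\<exists>w. Q (prod_encode (w, x)))))"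

lemma semidecidable_decidable:
  assumes "decidable P"
  shows "semidecidable P"
  unfolding semidecidable_def
  by (rule exI[of _ "\<lambda>p. P (psnd p)"])
    (simp add: decidable_compose[OF assms] total_computable_psnd_id)

text \<open>One new witness codes the old witness together with \<open>y\<close>.\<close>

lemma semidecidable_ex:
  assumes "semidecidable (\<lambda>p. P (pfst p) (psnd p))"
  shows "semidecidable (\<lambda>x. \<exists>y. P y x)"
proof -
  obtain Q where Q: "decidable Q"
    "\<And>p. P (pfst p) (psnd p) \<longleftrightarrow> (\<exists>w. Q (prod_encode (w, p)))"
    using assms unfolding semidecidable_def by blast
  have "P y x \<longleftrightarrow> (\<exists>w. Q (prod_encode (w, prod_encode (y, x))))" for x y
    using Q(2)[of "prod_encode (y, x)"] by simp
  then have "(\<exists>y. P y x) \<longleftrightarrow>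
      (\<exists>w. Q (prod_encode (pfst w, prod_encode (psnd w, x))))" for x
    by (metis pfst_pair psnd_pair)
  moreover have "decidable (\<lambda>p. Q (prod_encode (pfst (pfst p),
      prod_encode (psnd (pfst p), psnd p))))"
    by (intro decidable_compose[OF Q(1)] total_computable_basic)
  ultimately show ?thesis
    unfolding semidecidable_def by (intro exI conjI) auto
qed

lemma semidecidable_conj:
  assumes "semidecidable P" "semidecidable P'"
  shows "semidecidable (\<lambda>x. P x \<and> P' x)"
proof -
  obtain Q Q' where Q: "decidable Q" "\<And>x. P x \<longleftrightarrow> (\<exists>w. Q (prod_encode (w, x)))"
      "decidable Q'" "\<And>x. P' x \<longleftrightarrow> (\<exists>w. Q' (prod_encode (w, x)))"
    using assms unfolding semidecidable_def by blast
  have "decidable (\<lambda>p. Q (prod_encode (pfst (pfst p), psnd p))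
      \<and> Q' (prod_encode (psnd (pfst p), psnd p)))"
    by (intro decidable_conj decidable_compose[OF Q(1)] decidable_compose[OF Q(3)]
        total_computable_basic)
  moreover have "P x \<and> P' x \<longleftrightarrow> (\<exists>w. Q (prod_encode (pfst w, x))
      \<and> Q' (prod_encode (psnd w, x)))" for x
    unfolding Q(2,4) by (metis pfst_pair psnd_pair)
  ultimately show ?thesis
    unfolding semidecidable_def by (intro exI conjI) auto
qed

text \<open>An unbounded search runs through pairs of a witness and a candidate value; the second
  component of the first success is the value of \<open>g\<close>.\<close>

lemma semidecidable_uniformization:
  assumes "semidecidable (\<lambda>p. P (pfst p) (psnd p))" "\<And>x. \<exists>y. P y x"
  obtains g where "total_computable g" "\<And>x. P (g x) x"
proof -
  obtain Q where Q: "decidable Q"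
    "\<And>p. P (pfst p) (psnd p) \<longleftrightarrow> (\<exists>w. Q (prod_encode (w, p)))"
    using assms unfolding semidecidable_def by blast
  have P: "P y x \<longleftrightarrow> (\<exists>w. Q (prod_encode (w, prod_encode (y, x))))" for x y
    using Q(2)[of "prod_encode (y, x)"] by simp
  let ?R = "\<lambda>w x. Q (prod_encode (pfst w, prod_encode (psnd w, x)))"
  have ex: "\<exists>w. ?R w x" for x
    using assms(2)[of x] unfolding P by (metis pfst_pair psnd_pair)
  have "total_computable (\<lambda>x. LEAST w. ?R w x)"
    by (intro total_computable_Least decidable_compose[OF Q(1)] total_computable_basic ex)
  then have "total_computable (\<lambda>x. psnd (LEAST w. ?R w x))"
    by (rule total_computable_psnd)
  moreover have "P (psnd (LEAST w. ?R w x)) x" for x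
    using LeastI_ex[OF ex[of x]] unfolding P by blast
  ultimately show thesis by (rule that)
qed

text \<open>Finite sets are exactly the sets \<open>set_decode D\<close>, so soundness and
  completeness turn evaluation into an existential quantifier over codes. The argument list
  \<open>[x]\<close> has code \<open>lcons x 0\<close>.\<close>

lemma phi_iff: "phi e x = Some v \<longleftrightarrow>
    (\<exists>D. closed (set_decode D) \<and> eval_fact e (lcons x 0) v \<in> set_decode D)"
proof
  assume "phi e x = Some v"
  then have "certified e (lcons x 0) v"
    by (intro certified_complete) (simp add: phi_def)
  then show "\<exists>D. closed (set_decode D) \<and> eval_fact e (lcons x 0) v \<in> set_decode D"
    unfolding certified_def by (metis set_encode_inverse)
next
  assume "\<exists>D. closed (set_decode D) \<and> eval_fact e (lcons x 0) v \<in> set_decode D"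
  then obtain D where "eval (decode e) (list_decode (lcons x 0)) = Some v"
    using closed_sound by blast
  then show "phi e x = Some v" by (simp add: phi_def)
qed

lemma semidecidable_phi:
  assumes "total_computable e" "total_computable f" "total_computable v"
  shows "semidecidable (\<lambda>x. phi (e x) (f x) = Some (v x))"
  unfolding phi_iff
  by (intro semidecidable_ex semidecidable_decidable decidable_conj
      decidable_compose[OF decidable_closed] decidable_set_decode total_computable_eval_fact
      total_computable_lcons total_computable_basic total_computable_compose[OF assms(1)]
      total_computable_compose[OF assms(2)] total_computable_compose[OF assms(3)])

subsection \<open>Iterated halting jumps of the identity\<close>

text \<open>The sequence \<open>x\<^sub>k\<close> of the introduction. The recursion splits off the
  first application, as \<open>halting_jump\<close> does.\<close>

primrec diag_iter :: "nat \<Rightarrow> nat \<Rightarrow> nat option" where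
  "diag_iter 0 x = Some x"
| "diag_iter (Suc k) x = Option.bind (phi x x) (diag_iter k)"

lemma semidecidable_diag_iter:
  assumes "total_computable f" "total_computable u"
  shows "semidecidable (\<lambda>x. diag_iter k (f x) = Some (u x))"
  using assms
proof (induction k arbitrary: f u)
  case 0
  then show ?case by (simp add: semidecidable_decidable decidable_eq)
next
  case (Suc k)
  have "semidecidable (\<lambda>x. \<exists>y. phi (f x) (f x) = Some y \<and> diag_iter k y = Some (u x))"
    by (intro semidecidable_ex semidecidable_conj semidecidable_phi Suc.IH total_computable_basic
        total_computable_compose[OF Suc.prems(1)] total_computable_compose[OF Suc.prems(2)])
  then show ?case by (simp add: bind_eq_Some_conv)
qed

text \<open>Level \<open>0\<close> accounts for the clause \<open>x = y\<close> of the jump, and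
  level \<open>Suc k\<close> of \<open>x\<close> is level \<open>k\<close> of the diagonal value
  \<open>phi x x\<close>.\<close>

lemma omega_jump_iff:
  "omega_jump n x y \<longleftrightarrow> (\<exists>k\<le>n. \<exists>u. diag_iter k x = Some u \<and> diag_iter k y = Some u)"
proof (induction n arbitrary: x y)
  case (Suc n)
  have split: "(\<exists>k\<le>Suc n. P k) \<longleftrightarrow> P 0 \<or> (\<exists>k\<le>n. P (Suc k))" for P
  proof safe
    fix k assume "P k" "k \<le> Suc n" "\<not> (\<exists>k\<le>n. P (Suc k))"
    then show "P 0" by (cases k) auto
  qed auto
  show ?case
    unfolding split omega_jump.simps halting_jump_def Suc by (auto simp: bind_eq_Some_conv)
qed auto

text \<open>Once the two sequences meet they coincide from then on; the equation between options
  includes the case that both become undefined.\<close>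

lemma diag_iter_eq_mono:
  "diag_iter k x = Some u \<Longrightarrow> diag_iter k y = Some u \<Longrightarrow> k \<le> l \<Longrightarrow> diag_iter l x = diag_iter l y"
proof (induction k arbitrary: l x y)
  case (Suc k)
  obtain l' where l: "l = Suc l'" "k \<le> l'" using Suc.prems(3) by (cases l) auto
  obtain x' y' where "phi x x = Some x'" "diag_iter k x' = Some u"
    "phi y y = Some y'" "diag_iter k y' = Some u"
    using Suc.prems(1,2) by (auto simp: bind_eq_Some_conv)
  with Suc.IH[of x' y' l'] l show ?case by simp
qed simp

subsection \<open>Hypersimple sets\<close>

text \<open>A point of the complement above \<open>x\<close> separates \<open>x\<close> from
  everything beyond that point.\<close>

lemma F_rel_unrelated_far:
  assumes "infinite (- A)"
  obtains b where "\<And>y. y > b \<Longrightarrow> \<not> F_rel A x y"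
proof -
  obtain z where z: "z > x" "z \<notin> A"
    using assms unfolding infinite_nat_iff_unbounded by auto
  then have "\<not> F_rel A x y" if "y > z" for y
    using that by (auto simp: F_rel_def intro!: exI[of _ z])
  then show thesis by (rule that)
qed

text \<open>Iterating \<open>g\<close>, each time from just above the previous bound, yields
  \<open>G\<close>. A fresh element of the complement lies above \<open>G n\<close> and at most at
  \<open>G (Suc n)\<close>, so \<open>G\<close> dominates the enumeration.\<close>

lemma not_hypersimple_if_computable_hits:
  assumes g: "total_computable g" and hit: "\<And>a. \<exists>z. z \<notin> A \<and> a \<le> z \<and> z \<le> g a"
  shows "\<not> hypersimple A"
proof -
  define G where "G n = rec_nat (g 0) (\<lambda>_ r. g (Suc r)) n" for n
  have "total_computable G"
    unfolding G_def
    by (intro total_computable_rec_nat total_computable_basic total_computable_compose[OF g])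
  moreover have "enumerate (- A) n \<le> G n" for n
  proof (induction n)
    case 0
    obtain z where "z \<notin> A" "z \<le> g 0" using hit by blast
    then show ?case
      unfolding enumerate_0 G_def by (auto intro: Least_le order_trans)
  next
    case (Suc n)
    obtain z where z: "z \<notin> A" "Suc (G n) \<le> z" "z \<le> g (Suc (G n))" using hit by blast
    have inf: "infinite (- A)"
      unfolding infinite_nat_iff_unbounded_le using hit by auto
    have "enumerate (- A) (Suc n) \<le> z"
      unfolding enumerate_Suc''[OF inf] using z Suc by (intro Least_le) auto
    also have "z \<le> G (Suc n)" using z(3) by (simp add: G_def)
    finally show ?case .
  qed
  ultimately show ?thesis unfolding hypersimple_def by blast
qed

theorem theorem8p10:
  fixes A :: "nat set" and n :: nat
  assumes "hypersimple A"
  shows "\<not> reducible (F_rel A) (omega_jump n)"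
proof
  assume "reducible (F_rel A) (omega_jump n)"
  then obtain f where f: "total_computable f"
    and red: "\<And>x y. F_rel A x y \<longleftrightarrow> omega_jump n (f x) (f y)"
    unfolding reducible_def by blast
  have coinf: "infinite (- A)" using assms unfolding hypersimple_def by blast
  define S where "S k = {x. diag_iter k (f x) \<noteq> None}" for k
  \<comment> \<open>The maximum exists: level \<open>0\<close> is defined everywhere, and only
    levels up to \<open>n\<close> compete.\<close>
  define k where "k = (GREATEST k. k \<le> n \<and> infinite (S k))"
  have "infinite (S 0)" by (simp add: S_def)
  then have k: "k \<le> n \<and> infinite (S k)"
    unfolding k_def using GreatestI_nat[of "\<lambda>k. k \<le> n \<and> infinite (S k)" 0 n] by auto
  have "finite (S l)" if "k < l" "l \<le> n" for l
    using that Greatest_le_nat[of "\<lambda>k. k \<le> n \<and> infinite (S k)" l n] unfolding k_def by force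
  then have "finite (\<Union>l\<in>{k<..n}. S l)" by auto
  then obtain m where m: "\<And>x. x \<in> (\<Union>l\<in>{k<..n}. S l) \<Longrightarrow> x < m"
    unfolding finite_nat_set_iff_bounded by blast
  let ?separated = "\<lambda>x y. \<exists>u v. diag_iter k (f x) = Some u \<and> diag_iter k (f y) = Some v \<and> u \<noteq> v"
  have sep: "\<exists>x y. a + m \<le> x \<and> a + m \<le> y \<and> ?separated x y" for a
  proof -
    obtain x where x: "x \<in> S k" "a + m \<le> x"
      using k unfolding infinite_nat_iff_unbounded_le by blast
    obtain b where b: "\<And>y. y > b \<Longrightarrow> \<not> F_rel A x y"
      using F_rel_unrelated_far[OF coinf] by blast
    obtain y where y: "y \<in> S k" "y > max x b"
      using k unfolding infinite_nat_iff_unbounded by blast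
    then have "\<not> omega_jump n (f x) (f y)" using b[of y] red by simp
    \<comment> \<open>Both values at level \<open>k\<close> are defined; since
      \<open>k \<le> n\<close>, their equality would relate \<open>f x\<close> and
      \<open>f y\<close>.\<close>
    then have "?separated x y"
      using x y k unfolding omega_jump_iff S_def by auto
    with x y show ?thesis by (intro exI[of _ x] exI[of _ y]) auto
  qed
  \<comment> \<open>With \<open>a\<close> as second component of \<open>p\<close>, the search need
    only return an upper bound for a separated pair; the pair itself stays existentially
    quantified.\<close>
  have "semidecidable (\<lambda>p. \<exists>x y u v. psnd p + m \<le> x \<and> psnd p + m \<le> y \<and> x \<le> pfst p \<and> y \<le> pfst p
      \<and> diag_iter k (f x) = Some u \<and> diag_iter k (f y) = Some v \<and> u \<noteq> v)"
    by (intro semidecidable_ex semidecidable_conj semidecidable_diag_iter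
        total_computable_compose[OF f] total_computable_basic
        semidecidable_decidable[OF decidable_le]
        semidecidable_decidable[OF decidable_not[OF decidable_eq]])
  moreover have "\<exists>b x y u v. a + m \<le> x \<and> a + m \<le> y \<and> x \<le> b \<and> y \<le> b
      \<and> diag_iter k (f x) = Some u \<and> diag_iter k (f y) = Some v \<and> u \<noteq> v" for a
    using sep[of a] by (meson max.cobounded1 max.cobounded2)
  ultimately obtain g where g: "total_computable g"
    "\<And>a. \<exists>x y u v. a + m \<le> x \<and> a + m \<le> y \<and> x \<le> g a \<and> y \<le> g a
      \<and> diag_iter k (f x) = Some u \<and> diag_iter k (f y) = Some v \<and> u \<noteq> v"
    by (rule semidecidable_uniformization) blast
  have "\<exists>z. z \<notin> A \<and> a \<le> z \<and> z \<le> g a" for a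
  proof -
    obtain x y u v where xy: "a + m \<le> x" "a + m \<le> y" "x \<le> g a" "y \<le> g a"
      "diag_iter k (f x) = Some u" "diag_iter k (f y) = Some v" "u \<noteq> v"
      using g(2)[of a] by blast
    have "\<not> omega_jump n (f x) (f y)"
    proof
      assume "omega_jump n (f x) (f y)"
      then obtain l w where l: "l \<le> n" "diag_iter l (f x) = Some w" "diag_iter l (f y) = Some w"
        unfolding omega_jump_iff by blast
      show False
      \<comment> \<open>Agreement at a level up to \<open>k\<close> would persist to level
        \<open>k\<close>, where the values differ. A level above \<open>k\<close> is defined only at
        arguments below \<open>m\<close>, but \<open>x\<close> is at least
        \<open>a + m\<close>.\<close>
      proof (cases "l \<le> k")
        case True
        then show False using diag_iter_eq_mono[OF l(2,3)] xy by simp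
      next
        case False
        then have "x < m" using l by (intro m) (auto simp: S_def)
        then show False using xy by simp
      qed
    qed
    then have "\<not> F_rel A x y" using red by simp
    then obtain z where "min x y \<le> z" "z \<le> max x y" "z \<notin> A" unfolding F_rel_def by blast
    then show ?thesis using xy by (intro exI[of _ z]) auto
  qed
  then have "\<not> hypersimple A" by (rule not_hypersimple_if_computable_hits[OF g(1)])
  with assms show False by contradiction
qed

end
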